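(* Let $G$ be a finite simple graph and let $\mathcal{P}_c$ be the natural height-$2$ poset associated with its extended double cover. Then $\frac{\dim(\mathcal{P}_c)}{2}-2\le \mathrm{box}(G)\le 2\dim(\mathcal{P}_c)$; in particular $\mathrm{box}(G)=\Theta(\dim(\mathcal{P}_c))$.
   Context: The extended double cover $G_c$ of $G$ is the bipartite graph with partite sets $A$ and $B$, copies of $V(G)$, with vertices $u_A\in A$, $u_B\in B$ for each $u\in V(G)$, where $\{u_A,v_B\}$ is an edge iff $u=v$ or $\{u,v\}\in E(G)$. The natural poset $\mathcal{P}_c$ has ground set $A\cup B$, with $u_A<v_B$ iff $\{u_A,v_B\}\in E(G_c)$ and no other strict relations (so $A$ is the set of minimal elements and $B$ the set of maximal elements). Boxicity $\mathrm{box}(G)$: minimum $k$ such that vertices map to products of $k$ closed real intervals with adjacency iff intersection (complete graphs have boxicity $0$). Poset dimension: minimum number of linear extensions whose intersection is the order. *)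

theory Defs
  imports Complex_Main "HOL-Library.FuncSet" "HOL-Library.Landau_Symbols"
    "HOL-Library.Going_To_Filter"
begin

record 'a sgraph =
  verts :: "'a set"
  edges :: "'a set set"

definition finite_simple_graph :: "'a sgraph \<Rightarrow> bool" where
  "finite_simple_graph G \<longleftrightarrow>
     finite (verts G) \<and> (\<forall>e\<in>edges G. e \<subseteq> verts G \<and> card e = 2)"

definition interval_box :: "nat \<Rightarrow> (nat \<Rightarrow> real) \<Rightarrow> (nat \<Rightarrow> real) \<Rightarrow> (nat \<Rightarrow> real) set" where
  "interval_box k l h = (\<Pi>\<^sub>E i\<in>{..<k}. {l i..h i})"

text \<open>For \<^term>\<open>k = 0\<close> all boxes are the same singleton, so exactly the complete graphs
  have a 0-dimensional representation.\<close>

definition box_representation ::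
    "'a sgraph \<Rightarrow> nat \<Rightarrow> ('a \<Rightarrow> nat \<Rightarrow> real) \<Rightarrow> ('a \<Rightarrow> nat \<Rightarrow> real) \<Rightarrow> bool" where
  "box_representation G k l h \<longleftrightarrow>
     (\<forall>v\<in>verts G. \<forall>i<k. l v i \<le> h v i) \<and>
     (\<forall>u\<in>verts G. \<forall>v\<in>verts G. u \<noteq> v \<longrightarrow>
        ({u, v} \<in> edges G \<longleftrightarrow>
          interval_box k (l u) (h u) \<inter> interval_box k (l v) (h v) \<noteq> {}))"

definition boxicity :: "'a sgraph \<Rightarrow> nat" where
  "boxicity G = (LEAST k. \<exists>l h. box_representation G k l h)"

text \<open>A poset is a ground set together with its reflexive order relation, in the sense of
  \<^const>\<open>partial_order_on\<close>.\<close>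

type_synonym 'p poset = "'p set \<times> 'p rel"

definition linear_extension :: "'p poset \<Rightarrow> 'p rel \<Rightarrow> bool" where
  "linear_extension P L \<longleftrightarrow> linear_order_on (fst P) L \<and> snd P \<subseteq> L"

definition realizer :: "'p poset \<Rightarrow> 'p rel set \<Rightarrow> bool" where
  "realizer P R \<longleftrightarrow> R \<noteq> {} \<and> (\<forall>L\<in>R. linear_extension P L) \<and> \<Inter>R = snd P"

definition poset_dim :: "'p poset \<Rightarrow> nat" where
  "poset_dim P = (LEAST k. \<exists>R. finite R \<and> card R = k \<and> realizer P R)"

text \<open>In the extended double cover, \<^term>\<open>Inl u\<close> and \<^term>\<open>Inr u\<close> are the copies of the
  vertex \<^term>\<open>u\<close> in the partite sets $A$ and $B$, respectively.\<close>

definition extended_double_cover :: "'a sgraph \<Rightarrow> ('a + 'a) sgraph" where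
  "extended_double_cover G =
     \<lparr>verts = verts G <+> verts G,
      edges = {{Inl u, Inr v} | u v.
        u \<in> verts G \<and> v \<in> verts G \<and> (u = v \<or> {u, v} \<in> edges G)}\<rparr>"

definition cover_poset :: "'a sgraph \<Rightarrow> ('a + 'a) poset" where
  "cover_poset G =
     (verts (extended_double_cover G),
      Id_on (verts (extended_double_cover G)) \<union>
      {(Inl u, Inr v) | u v. {Inl u, Inr v} \<in> edges (extended_double_cover G)})"

lemma partial_order_cover_poset:
  "partial_order_on (fst (cover_poset G)) (snd (cover_poset G))"
  by (auto simp: partial_order_on_def preorder_on_def refl_on_def trans_def antisym_def
      cover_poset_def extended_double_cover_def doubleton_eq_iff)

end

theory Submission
  imports Defs "HOL-Library.Product_Lexorder"
begin

text \<open>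
  A linear extension \<open>L\<close> of the cover poset puts \<open>u\<^sub>A\<close> below \<open>u\<^sub>B\<close>, so it assigns to each vertex the
  interval between these two positions; the intervals of \<open>u\<close> and \<open>v\<close> are disjoint exactly when \<open>L\<close>
  puts \<open>v\<^sub>B\<close> below \<open>u\<^sub>A\<close> or \<open>u\<^sub>B\<close> below \<open>v\<^sub>A\<close>. Hence a realizer of size \<open>d\<close> is a box
  representation of dimension \<open>d\<close>. Conversely, each coordinate of a box representation yields the
  linear extension that sorts \<open>u\<^sub>A\<close> by left and \<open>u\<^sub>B\<close> by right end points, and the one obtained
  from the mirrored intervals. These \<open>2k\<close> extensions reverse all incomparable pairs between \<open>A\<close> and
  \<open>B\<close>; two more, with all of \<open>A\<close> below all of \<open>B\<close>, reverse the remaining ones. So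
  \<open>box \<le> dim \<le> 2 box + 2\<close>.
\<close>

section \<open>Box representations by end point inequalities\<close>

lemma interval_box_Int_nonempty_iff:
  assumes "\<forall>i<k. l i \<le> h i" "\<forall>i<k. l' i \<le> h' i"
  shows "interval_box k l h \<inter> interval_box k l' h' \<noteq> {} \<longleftrightarrow>
    (\<forall>i<k. l i \<le> h' i \<and> l' i \<le> h i)"
  using assms by (auto simp: interval_box_def PiE_Int PiE_eq_empty_iff)

lemma box_representation_iff:
  "box_representation G k l h \<longleftrightarrow>
     (\<forall>v\<in>verts G. \<forall>i<k. l v i \<le> h v i) \<and>
     (\<forall>u\<in>verts G. \<forall>v\<in>verts G. u \<noteq> v \<longrightarrow>
        ({u, v} \<in> edges G \<longleftrightarrow> (\<forall>i<k. l u i \<le> h v i \<and> l v i \<le> h u i)))"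
  unfolding box_representation_def
  using interval_box_Int_nonempty_iff[of k] by (smt (verit, best))

text \<open>Each vertex \<open>w\<close> gets its own coordinate: \<open>w\<close> is the point 0,
  its neighbours are [0,1], all other vertices are the point 1. This coordinate separates
  \<open>w\<close> from exactly its non-neighbours and no other pair.\<close>

lemma box_representation_exists:
  assumes "finite_simple_graph G"
  shows "\<exists>k l h. box_representation G k l h"
proof -
  have "finite (verts G)" using assms by (simp add: finite_simple_graph_def)
  then obtain e where e: "bij_betw e {..<card (verts G)} (verts G)"
    using ex_bij_betw_nat_finite lessThan_atLeast0 by metis
  define l h :: "'a \<Rightarrow> nat \<Rightarrow> real"
    where "l = (\<lambda>v i. if v = e i \<or> {v, e i} \<in> edges G then 0 else 1)"
      and "h = (\<lambda>v i. if v = e i then 0 else 1)"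
  have nonadj: "\<exists>i<card (verts G). \<not> (l u i \<le> h v i \<and> l v i \<le> h u i)"
    if "u \<in> verts G" "u \<noteq> v" "{u, v} \<notin> edges G" for u v
  proof -
    obtain i where "i < card (verts G)" "e i = u"
      using e \<open>u \<in> verts G\<close> by (metis bij_betw_imp_surj_on imageE lessThan_iff)
    then show ?thesis using that by (auto simp: l_def h_def insert_commute)
  qed
  have adj: "l u i \<le> h v i \<and> l v i \<le> h u i" if "{u, v} \<in> edges G" for u v i
    using that by (auto simp: l_def h_def insert_commute)
  have "l v i \<le> h v i" for v i by (simp add: l_def h_def)
  then have "box_representation G (card (verts G)) l h"
    unfolding box_representation_iff using nonadj adj by metis
  then show ?thesis by blast
qed

section \<open>From realizers to box representations\<close>

lemma fst_cover_poset: "fst (cover_poset G) = verts G <+> verts G"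
  by (simp add: cover_poset_def extended_double_cover_def)

lemma snd_cover_poset:
  "snd (cover_poset G) = Id_on (verts G <+> verts G) \<union>
     {(Inl u, Inr v) | u v. u \<in> verts G \<and> v \<in> verts G \<and> (u = v \<or> {u, v} \<in> edges G)}"
  by (auto simp: cover_poset_def extended_double_cover_def doubleton_eq_iff)

lemma linear_order_on_inj_key:
  fixes f :: "'p \<Rightarrow> 'b::linorder"
  assumes "inj_on f X"
  shows "linear_order_on X {(x, y). x \<in> X \<and> y \<in> X \<and> f x \<le> f y}"
  using assms
  by (auto simp: linear_order_on_def partial_order_on_def preorder_on_def refl_on_def trans_def
      antisym_def total_on_def inj_on_def)

text \<open>Down-sets of a linear order are nested, and strictly so for distinct elements since each
  element lies in its own down-set. Their sizes thus serve as numerical positions, which become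
  interval end points.\<close>

lemma linear_order_on_rank:
  assumes "linear_order_on X L" "finite X" "x \<in> X" "y \<in> X"
  shows "(x, y) \<in> L \<longleftrightarrow> card {z. (z, x) \<in> L} \<le> card {z. (z, y) \<in> L}"
proof -
  have L: "refl_on X L" "trans L" "antisym L" "total_on X L" "L \<subseteq> X \<times> X"
    using assms(1)
    by (auto simp: linear_order_on_def partial_order_on_def preorder_on_def refl_on_def)
  then have fin: "finite {z. (z, w) \<in> L}" for w
    by (auto intro: finite_subset[OF _ assms(2)])
  show ?thesis
  proof
    assume "(x, y) \<in> L"
    then have "{z. (z, x) \<in> L} \<subseteq> {z. (z, y) \<in> L}"
      using L(2) by (auto dest: transD)
    then show "card {z. (z, x) \<in> L} \<le> card {z. (z, y) \<in> L}"
      by (rule card_mono[OF fin])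
  next
    assume le: "card {z. (z, x) \<in> L} \<le> card {z. (z, y) \<in> L}"
    show "(x, y) \<in> L"
    proof (rule ccontr)
      assume neg: "(x, y) \<notin> L"
      then have "(y, x) \<in> L"
        using L(1,4) assms(3,4) by (metis refl_onD total_on_def)
      then have "{z. (z, y) \<in> L} \<subseteq> {z. (z, x) \<in> L}"
        using L(2) by (auto dest: transD)
      moreover have "(x, x) \<in> L" using L(1) assms(3) by (rule refl_onD)
      ultimately have "{z. (z, y) \<in> L} \<subset> {z. (z, x) \<in> L}"
        using neg by blast
      then have "card {z. (z, y) \<in> L} < card {z. (z, x) \<in> L}"
        by (rule psubset_card_mono[OF fin])
      then show False using le by simp
    qed
  qed
qed

lemma realizer_imp_box_representation:
  assumes G: "finite_simple_graph G" and R: "finite R" "realizer (cover_poset G) R"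
  shows "\<exists>l h. box_representation G (card R) l h"
proof -
  obtain L where "bij_betw L {..<card R} R"
    using ex_bij_betw_nat_finite[OF R(1)] lessThan_atLeast0 by metis
  then have L: "L ` {..<card R} = R" by (simp add: bij_betw_def)
  let ?X = "verts G <+> verts G"
  define pos :: "nat \<Rightarrow> 'a + 'a \<Rightarrow> real" where "pos = (\<lambda>i x. card {z. (z, x) \<in> L i})"
  have lin: "linear_order_on ?X (L i)" if "i < card R" for i
    using R(2) L that by (auto simp: realizer_def linear_extension_def fst_cover_poset)
  have fin: "finite ?X" using G by (simp add: finite_simple_graph_def)
  have pos: "pos i x \<le> pos i y \<longleftrightarrow> (x, y) \<in> L i"
    if "i < card R" "x \<in> ?X" "y \<in> ?X" for i x y
    using linear_order_on_rank[OF lin fin] that by (simp add: pos_def)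
  have L_Int: "snd (cover_poset G) = (\<Inter>i<card R. L i)"
    using R(2) L by (simp add: realizer_def)
  \<comment> \<open>The case \<open>u = v\<close> makes the intervals nonempty; the case
    \<open>u \<noteq> v\<close>, used in both directions, gives the intersection criterion.\<close>
  have adj: "(\<forall>i<card R. pos i (Inl u) \<le> pos i (Inr v)) \<longleftrightarrow> u = v \<or> {u, v} \<in> edges G"
    if "u \<in> verts G" "v \<in> verts G" for u v
  proof -
    have "(\<forall>i<card R. pos i (Inl u) \<le> pos i (Inr v)) \<longleftrightarrow> (Inl u, Inr v) \<in> (\<Inter>i<card R. L i)"
      using that by (auto simp: pos InlI InrI)
    also have "\<dots> \<longleftrightarrow> u = v \<or> {u, v} \<in> edges G"
      unfolding L_Int[symmetric] using that by (auto simp: snd_cover_poset)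
    finally show ?thesis .
  qed
  have "{u, v} \<in> edges G \<longleftrightarrow>
      (\<forall>i<card R. pos i (Inl u) \<le> pos i (Inr v) \<and> pos i (Inl v) \<le> pos i (Inr u))"
    if "u \<in> verts G" "v \<in> verts G" "u \<noteq> v" for u v
    using adj[of u v] adj[of v u] that by (auto simp: insert_commute)
  then have "box_representation G (card R) (\<lambda>v i. pos i (Inl v)) (\<lambda>v i. pos i (Inr v))"
    unfolding box_representation_iff using adj by blast
  then show ?thesis by blast
qed

section \<open>From box representations to realizers\<close>

text \<open>The linear order that puts \<open>u\<^sub>A\<close> at \<open>p u\<close> and \<open>u\<^sub>B\<close> at \<open>q u\<close>. In a tie \<open>A\<close> comes before \<open>B\<close>,
  since closed intervals that touch do intersect; further ties are broken by \<open>g\<close>.\<close>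

definition cover_key ::
    "('a \<Rightarrow> real) \<Rightarrow> ('a \<Rightarrow> real) \<Rightarrow> ('a \<Rightarrow> real) \<Rightarrow> 'a + 'a \<Rightarrow> real \<times> bool \<times> real" where
  "cover_key p q g = case_sum (\<lambda>u. (p u, False, g u)) (\<lambda>u. (q u, True, g u))"

definition cover_order ::
    "'a sgraph \<Rightarrow> ('a \<Rightarrow> real) \<Rightarrow> ('a \<Rightarrow> real) \<Rightarrow> ('a \<Rightarrow> real) \<Rightarrow> ('a + 'a) rel" where
  "cover_order G p q g =
     {(x, y). x \<in> verts G <+> verts G \<and> y \<in> verts G <+> verts G \<and>
        cover_key p q g x \<le> cover_key p q g y}"

lemma cover_order_simps:
  "(Inl u, Inl v) \<in> cover_order G p q g \<longleftrightarrow>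
     u \<in> verts G \<and> v \<in> verts G \<and> (p u < p v \<or> p u = p v \<and> g u \<le> g v)"
  "(Inr u, Inr v) \<in> cover_order G p q g \<longleftrightarrow>
     u \<in> verts G \<and> v \<in> verts G \<and> (q u < q v \<or> q u = q v \<and> g u \<le> g v)"
  "(Inl u, Inr v) \<in> cover_order G p q g \<longleftrightarrow> u \<in> verts G \<and> v \<in> verts G \<and> p u \<le> q v"
  "(Inr u, Inl v) \<in> cover_order G p q g \<longleftrightarrow> u \<in> verts G \<and> v \<in> verts G \<and> q u < p v"
  by (auto simp: cover_order_def cover_key_def)

text \<open>Injectivity of \<open>g\<close> makes the keys distinct, hence the order antisymmetric;
  the second assumption covers exactly the relations from \<open>A\<close> to
  \<open>B\<close>.\<close>

lemma linear_extension_cover_order: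
  assumes "inj_on g (verts G)"
    and "\<And>u v. u \<in> verts G \<Longrightarrow> v \<in> verts G \<Longrightarrow> u = v \<or> {u, v} \<in> edges G \<Longrightarrow> p u \<le> q v"
  shows "linear_extension (cover_poset G) (cover_order G p q g)"
proof -
  have "inj_on (cover_key p q g) (verts G <+> verts G)"
  proof (rule inj_onI)
    fix x y
    assume "x \<in> verts G <+> verts G" "y \<in> verts G <+> verts G"
      "cover_key p q g x = cover_key p q g y"
    then show "x = y"
      by (cases x; cases y) (auto simp: cover_key_def dest: inj_onD[OF assms(1)])
  qed
  then have "linear_order_on (verts G <+> verts G) (cover_order G p q g)"
    unfolding cover_order_def by (rule linear_order_on_inj_key)
  moreover have "snd (cover_poset G) \<subseteq> cover_order G p q g"
    using assms(2) by (auto simp: snd_cover_poset cover_order_simps)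
  ultimately show ?thesis by (simp add: linear_extension_def fst_cover_poset)
qed

lemma box_representation_imp_realizer:
  assumes G: "finite_simple_graph G" and B: "box_representation G k l h"
  shows "\<exists>R. finite R \<and> card R \<le> 2 * k + 2 \<and> realizer (cover_poset G) R"
proof -
  have "finite (verts G)" using G by (simp add: finite_simple_graph_def)
  then obtain g' :: "'a \<Rightarrow> nat" where "inj_on g' (verts G)"
    using finite_imp_inj_to_nat_seg by blast
  then obtain g :: "'a \<Rightarrow> real" where g: "inj_on g (verts G)"
    by (intro that[of "\<lambda>v. real (g' v)"]) (simp add: inj_on_def)
  then have g_minus: "inj_on (\<lambda>v. - g v) (verts G)" by (simp add: inj_on_def)
  \<comment> \<open>\<open>E i\<close> puts \<open>v\<^sub>B\<close> below \<open>u\<^sub>A\<close>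
    iff \<open>h v i < l u i\<close>, and \<open>E' i\<close> iff \<open>h u i < l v i\<close>: the
    two ways for the intervals to be disjoint.\<close>
  define E where "E = (\<lambda>i. cover_order G (\<lambda>v. l v i) (\<lambda>v. h v i) g)"
  define E' where "E' = (\<lambda>i. cover_order G (\<lambda>v. - h v i) (\<lambda>v. - l v i) g)"
  \<comment> \<open>With constant positions the tie rule puts \<open>A\<close> below
    \<open>B\<close>, and \<open>g\<close> and \<open>-g\<close> order each side in opposite
    ways.\<close>
  define F where "F = cover_order G (\<lambda>_. 0) (\<lambda>_. 0) g"
  define F' where "F' = cover_order G (\<lambda>_. 0) (\<lambda>_. 0) (\<lambda>v. - g v)"
  define R where "R = E ` {..<k} \<union> E' ` {..<k} \<union> {F, F'}"
  have valid: "l v i \<le> h v i" if "v \<in> verts G" "i < k" for v i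
    using B that by (auto simp: box_representation_iff)
  have adj: "{u, v} \<in> edges G \<longleftrightarrow> (\<forall>i<k. l u i \<le> h v i \<and> l v i \<le> h u i)"
      if "u \<in> verts G" "v \<in> verts G" "u \<noteq> v" for u v
    using B that by (auto simp: box_representation_iff)
  have le: "l u i \<le> h v i" "l v i \<le> h u i"
    if "u \<in> verts G" "v \<in> verts G" "i < k" "u = v \<or> {u, v} \<in> edges G" for u v i
    using that valid adj by metis+
  have ext: "linear_extension (cover_poset G) L" if "L \<in> R" for L
    using that le unfolding R_def E_def E'_def F_def F'_def
    by (auto intro!: linear_extension_cover_order g g_minus)
  have sub: "x \<in> snd (cover_poset G)" if x: "x \<in> \<Inter>R" for x
  proof -
    have F: "x \<in> F" "x \<in> F'" and E: "\<And>i. i < k \<Longrightarrow> x \<in> E i" "\<And>i. i < k \<Longrightarrow> x \<in> E' i"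
      using x by (auto simp: R_def)
    obtain a b where "x = (a, b)" by fastforce
    then consider u v where "x = (Inl u, Inl v)" | u v where "x = (Inr u, Inr v)"
      | u v where "x = (Inr u, Inl v)" | u v where "x = (Inl u, Inr v)"
      by (metis sumE)
    then show ?thesis
    proof cases
      case (4 u v)
      then have V: "u \<in> verts G" "v \<in> verts G" using F by (auto simp: F_def cover_order_simps)
      have "l u i \<le> h v i \<and> l v i \<le> h u i" if "i < k" for i
        using E[OF that] 4 by (auto simp: E_def E'_def cover_order_simps)
      then show ?thesis using 4 V adj by (auto simp: snd_cover_poset)
    \<comment> \<open>Within one side, \<open>F\<close> and \<open>F'\<close> together force
      \<open>u = v\<close>; a pair from \<open>B\<close> to \<open>A\<close> is never in
      \<open>F\<close>.\<close>
    qed (use F g in \<open>auto simp: F_def F'_def cover_order_simps snd_cover_poset inj_on_def\<close>)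
  qed
  have "realizer (cover_poset G) R"
    unfolding realizer_def
  proof (intro conjI)
    show "R \<noteq> {}" by (simp add: R_def)
    show "\<forall>L\<in>R. linear_extension (cover_poset G) L" using ext by blast
    show "\<Inter>R = snd (cover_poset G)"
      using ext sub unfolding linear_extension_def by blast
  qed
  \<comment> \<open>Only an upper bound, since some of these extensions may coincide.\<close>
  moreover have "card R \<le> 2 * k + 2"
  proof -
    have "card R \<le> card (E ` {..<k}) + card (E' ` {..<k}) + card {F, F'}"
      unfolding R_def by (meson card_Un_le add_le_mono1 order_trans)
    moreover have "card (E ` {..<k}) \<le> k" "card (E' ` {..<k}) \<le> k"
      using card_image_le[of "{..<k}"] by auto
    moreover have "card {F, F'} \<le> 2" by (simp add: card_insert_if)
    ultimately show ?thesis by linarith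
  qed
  moreover have "finite R" by (simp add: R_def)
  ultimately show ?thesis by blast
qed

section \<open>Comparison of the two minima\<close>

lemma poset_dim_cover_le:
  assumes "finite_simple_graph G"
  shows "poset_dim (cover_poset G) \<le> 2 * boxicity G + 2"
proof -
  obtain l h where "box_representation G (boxicity G) l h"
    unfolding boxicity_def using LeastI_ex[OF box_representation_exists[OF assms]] by blast
  then obtain R where R: "finite R" "card R \<le> 2 * boxicity G + 2" "realizer (cover_poset G) R"
    using box_representation_imp_realizer[OF assms] by blast
  then have "poset_dim (cover_poset G) \<le> card R"
    unfolding poset_dim_def by (intro Least_le) blast
  then show ?thesis using R(2) by linarith
qed

lemma boxicity_le_poset_dim_cover:
  assumes "finite_simple_graph G"
  shows "boxicity G \<le> poset_dim (cover_poset G)"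
proof -
  \<comment> \<open>Some finite realizer must exist before the minimum in \<open>poset_dim\<close>
    is known to be attained; any box representation supplies one.\<close>
  have "\<exists>k R. finite R \<and> card R = k \<and> realizer (cover_poset G) R"
    using box_representation_exists[OF assms] box_representation_imp_realizer[OF assms] by blast
  from LeastI_ex[OF this] obtain R
    where "finite R" "card R = poset_dim (cover_poset G)" "realizer (cover_poset G) R"
    unfolding poset_dim_def by blast
  then have "\<exists>l h. box_representation G (poset_dim (cover_poset G)) l h"
    using realizer_imp_box_representation[OF assms] by metis
  then show ?thesis unfolding boxicity_def by (rule Least_le)
qed

theorem theorem3:
  shows "(\<forall>G :: 'a sgraph. finite_simple_graph G \<longrightarrow>
            real (poset_dim (cover_poset G)) / 2 - 2 \<le> real (boxicity G) \<and>
            real (boxicity G) \<le> 2 * real (poset_dim (cover_poset G))) \<and>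
         (\<lambda>G :: 'a sgraph. real (boxicity G)) \<in>
           \<Theta>[(\<lambda>G. poset_dim (cover_poset G)) going_to at_top within {G. finite_simple_graph G}](
             \<lambda>G. real (poset_dim (cover_poset G)))"
proof -
  let ?F = "(\<lambda>G :: 'a sgraph. poset_dim (cover_poset G)) going_to at_top
    within {G. finite_simple_graph G}"
  have bounds: "real (poset_dim (cover_poset G)) / 2 - 2 \<le> real (boxicity G)"
    "real (boxicity G) \<le> 2 * real (poset_dim (cover_poset G))"
    if "finite_simple_graph G" for G :: "'a sgraph"
    using poset_dim_cover_le[OF that] boxicity_le_poset_dim_cover[OF that] by linarith+
  \<comment> \<open>From 8 on, \<open>d / 2 - 2 \<ge> d / 4\<close>, which absorbs the additive
    constant and gives the factor 4 below.\<close>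
  have ev: "eventually (\<lambda>G. finite_simple_graph G \<and> 8 \<le> poset_dim (cover_poset G)) ?F"
    unfolding eventually_going_to_at_top_linorder by blast
  have "(\<lambda>G. real (boxicity G)) \<in> O[?F](\<lambda>G. real (poset_dim (cover_poset G)))"
    by (rule bigoI[of _ 2], rule eventually_mono[OF ev]) (use bounds in auto)
  moreover have "(\<lambda>G. real (poset_dim (cover_poset G))) \<in> O[?F](\<lambda>G. real (boxicity G))"
  proof (rule bigoI[of _ 4], rule eventually_mono[OF ev])
    fix G :: "'a sgraph"
    assume "finite_simple_graph G \<and> 8 \<le> poset_dim (cover_poset G)"
    then show "norm (real (poset_dim (cover_poset G))) \<le> 4 * norm (real (boxicity G))"
      using bounds(1)[of G] by simp
  qed
  ultimately show ?thesis using bounds by (auto simp: bigtheta_def bigomega_iff_bigo)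
qed

end
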